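(* Fix $p>0$ and assume that $0<\mathbb{E}|X|^{p}<\infty$, where $X$ is a real random variable. For each $d\ge1$ let $\mathbf{X}_1,\dots,\mathbf{X}_n$ be i.i.d. random vectors in $\mathbb{R}^d$, each having i.i.d. components distributed as $X$. Then, for fixed $n$, as $d\to\infty$, $$d^{1/2-1/p}\left(\max_{1\le i\le n}\Vert\mathbf{X}_i\Vert_p-\min_{1\le i\le n}\Vert\mathbf{X}_i\Vert_p\right)\xrightarrow{\mathcal{D}}\frac{\sigma_p\mu_p^{1/p-1}}{p}\,M_n,$$ where $M_n=\max_{1\le i\le n}Z_i-\min_{1\le i\le n}Z_i$ with $Z_1,\dots,Z_n$ i.i.d. standard normal random variables.
   Context: For $\mathbf{x}=(x_1,\dots,x_d)\in\mathbb{R}^d$ and $0<p<\infty$, $\Vert\mathbf{x}\Vert_p=\left(\sum_{j=1}^d|x_j|^p\right)^{1/p}$ (for all $p>0$, even when $p<1$ and this is not a norm). Notation: whenever $\mathbb{E}|X|^p<\infty$, $\mu_p=\mathbb{E}|X|^p$; when $\operatorname{Var}|X|^p<\infty$, $\sigma_p^2=\operatorname{Var}|X|^p$ (with $\sigma_p\ge0$). The symbol $\xrightarrow{\mathcal{D}}$ denotes convergence in distribution.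
   Formalization: It is additionally assumed that Var|X|^p is finite, since otherwise σ_p in the limit is undefined; σ_p = 0 is allowed. *)

theory Defs
  imports "HOL-Probability.Probability"
begin

text \<open>
  Vectors of \<open>\<real>\<^sup>d\<close> are functions \<open>nat \<Rightarrow> real\<close> read on the index set \<open>{1..d}\<close>, and random vectors
  are random elements of the product space \<open>real_vec d\<close>. The dimension cannot be a type here, since
  it tends to infinity.
\<close>

definition real_vec :: "nat \<Rightarrow> (nat \<Rightarrow> real) measure" where
  "real_vec d = PiM {1..d} (\<lambda>_. borel)"

definition lp_norm :: "nat \<Rightarrow> real \<Rightarrow> (nat \<Rightarrow> real) \<Rightarrow> real" where
  "lp_norm d p x = (\<Sum>j\<in>{1..d}. \<bar>x j\<bar> powr p) powr (1 / p)"

text \<open>Measurability of each \<open>X i\<close> is part of \<^const>\<open>prob_space.indep_vars\<close>.\<close>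

definition iid :: "'a measure \<Rightarrow> 'b measure \<Rightarrow> 'i set \<Rightarrow> ('i \<Rightarrow> 'a \<Rightarrow> 'b) \<Rightarrow> bool" where
  "iid M S I X \<longleftrightarrow> prob_space.indep_vars M (\<lambda>_. S) X I \<and>
     (\<forall>i\<in>I. \<forall>j\<in>I. distr M S (X i) = distr M S (X j))"

definition abs_moment :: "'a measure \<Rightarrow> ('a \<Rightarrow> real) \<Rightarrow> real \<Rightarrow> real" where
  "abs_moment M X p = (LINT \<omega>|M. \<bar>X \<omega>\<bar> powr p)"

text \<open>
  The Bochner integral of a non-integrable function is \<open>0\<close>, so the two quantities \<open>abs_moment\<close>
  and \<open>abs_sd\<close> are meaningful only together with the corresponding integrability assumptions.
\<close>

definition abs_sd :: "'a measure \<Rightarrow> ('a \<Rightarrow> real) \<Rightarrow> real \<Rightarrow> real" where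
  "abs_sd M X p = sqrt (LINT \<omega>|M. (\<bar>X \<omega>\<bar> powr p - abs_moment M X p)\<^sup>2)"

end

theory Submission
  imports Defs
begin

text \<open>
  Write \<open>S\<^sub>i\<close> for the sum of the \<open>p\<close>-th powers of the coordinates of the \<open>i\<close>-th vector. The normalised
  sums \<open>W\<^sub>i = (S\<^sub>i - d \<mu>) / sqrt d\<close> are independent and each tends weakly to \<open>\<sigma> Z\<close> by the central limit
  theorem. Skorohod's theorem makes the convergence of one such sum pointwise on some space; on the
  product of \<open>n\<close> copies of that space all \<open>n\<close> coordinates converge pointwise, with the correct joint
  laws. There the delta method for the map \<open>x \<mapsto> x powr (1 / p)\<close> and the continuity of the maximum and
  minimum are statements about sequences of numbers, and pointwise convergence yields weak
  convergence of the range of the norms.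
\<close>

section \<open>Limits of numerical sequences: extrema and the delta method\<close>

lemma tendsto_MAX:
  fixes f :: "'i \<Rightarrow> 'a \<Rightarrow> real"
  assumes "finite I" "I \<noteq> {}" "\<And>i. i \<in> I \<Longrightarrow> (f i \<longlongrightarrow> l i) F"
  shows "((\<lambda>x. MAX i\<in>I. f i x) \<longlongrightarrow> (MAX i\<in>I. l i)) F"
  using assms by (induction rule: finite_ne_induct) (auto intro!: tendsto_max)

lemma tendsto_MIN:
  fixes f :: "'i \<Rightarrow> 'a \<Rightarrow> real"
  assumes "finite I" "I \<noteq> {}" "\<And>i. i \<in> I \<Longrightarrow> (f i \<longlongrightarrow> l i) F"
  shows "((\<lambda>x. MIN i\<in>I. f i x) \<longlongrightarrow> (MIN i\<in>I. l i)) F"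
  using assms by (induction rule: finite_ne_induct) (auto intro!: tendsto_min)

text \<open>A nondecreasing map commutes with maximum and minimum, and the shift cancels in the
  difference. It serves to pull nonnegative constants out of a range and to insert a common centring
  into one.\<close>

lemma range_affine:
  fixes f :: "'i \<Rightarrow> real"
  assumes "finite I" "I \<noteq> {}" "a \<ge> 0"
  shows "(MAX i\<in>I. a * f i + b) - (MIN i\<in>I. a * f i + b) = a * ((MAX i\<in>I. f i) - (MIN i\<in>I. f i))"
proof -
  have "mono (\<lambda>x. a * x + b)"
    using assms by (auto intro!: monoI mult_left_mono)
  from mono_Max_commute[OF this, of "f ` I"] mono_Min_commute[OF this, of "f ` I"] show ?thesis
    using assms by (simp add: image_image algebra_simps)
qed

text \<open>Caratheodory's form of the derivative gives \<open>f z - f m = g z * (z - m)\<close>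
  with \<open>g\<close> continuous at \<open>m\<close>. At \<open>z = m + w k / r k\<close> the
  factor \<open>r k\<close> cancels as soon as it is nonzero, leaving
  \<open>g z * w k\<close>.\<close>

lemma delta_method_sequence:
  fixes f :: "real \<Rightarrow> real"
  assumes f: "(f has_real_derivative D) (at m)"
    and w: "w \<longlonglongrightarrow> w'" and r: "filterlim r at_top sequentially"
  shows "(\<lambda>k. r k * (f (m + w k / r k) - f m)) \<longlonglongrightarrow> D * w'"
proof -
  obtain g where g: "\<And>z. f z - f m = g z * (z - m)" "isCont g m" "g m = D"
    using f unfolding CARAT_DERIV by blast
  have "(\<lambda>k. m + w k / r k) \<longlonglongrightarrow> m + 0"
    by (intro tendsto_intros real_tendsto_divide_at_top[OF w r])
  then have "(\<lambda>k. g (m + w k / r k)) \<longlonglongrightarrow> g m"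
    using isCont_tendsto_compose[OF g(2)] by simp
  then have lim: "(\<lambda>k. g (m + w k / r k) * w k) \<longlonglongrightarrow> D * w'"
    unfolding g(3)[symmetric] by (intro tendsto_mult w)
  have "eventually (\<lambda>k. g (m + w k / r k) * w k = r k * (f (m + w k / r k) - f m)) sequentially"
    using filterlim_at_top_dense[THEN iffD1, OF r, rule_format, of 0]
    by eventually_elim (simp add: g(1))
  from Lim_transform_eventually[OF lim this] show ?thesis .
qed

text \<open>With \<open>d = Suc k\<close>, taking \<open>d\<close> out of both bases leaves the
  power \<open>d powr (1 / 2 - 1 / p + 1 / p) = sqrt d\<close>. What remains is the delta method at
  \<open>m\<close> with rate \<open>sqrt d\<close>. The factorisation \<open>eq\<close> holds for
  every \<open>k\<close>, even where the perturbed base is not positive.\<close>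

lemma powr_increment_tendsto:
  fixes p m :: real
  assumes "p > 0" "m > 0" "w \<longlonglongrightarrow> w'"
  shows "(\<lambda>k. real (Suc k) powr (1 / 2 - 1 / p) *
      ((real (Suc k) * m + sqrt (real (Suc k)) * w k) powr (1 / p) - (real (Suc k) * m) powr (1 / p)))
    \<longlonglongrightarrow> m powr (1 / p - 1) / p * w'"
proof -
  have d: "((\<lambda>x. x powr (1 / p)) has_real_derivative (m powr (1 / p - 1) / p)) (at m)"
    using assms by (auto intro!: derivative_eq_intros simp: field_simps)
  have r: "filterlim (\<lambda>k. sqrt (real (Suc k))) at_top sequentially"
    by (intro filterlim_compose[OF sqrt_at_top] filterlim_compose[OF filterlim_real_sequentially]
        filterlim_Suc)
  have eq: "real (Suc k) powr (1 / 2 - 1 / p) *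
      ((real (Suc k) * m + sqrt (real (Suc k)) * w k) powr (1 / p) - (real (Suc k) * m) powr (1 / p))
    = sqrt (real (Suc k)) * ((m + w k / sqrt (real (Suc k))) powr (1 / p) - m powr (1 / p))" for k
  proof -
    define d where "d = real (Suc k)"
    have d: "d > 0" "sqrt d * sqrt d = d" by (simp_all add: d_def)
    have "d * m + sqrt d * w k = d * (m + w k / sqrt d)"
      using d by (simp add: field_simps)
    moreover have "d powr (1 / 2 - 1 / p) * d powr (1 / p) = sqrt d"
      using d by (simp add: powr_add[symmetric] powr_half_sqrt)
    ultimately show ?thesis
      unfolding d_def[symmetric] by (simp add: powr_mult right_diff_distrib mult.assoc[symmetric])
  qed
  show ?thesis
    unfolding eq by (rule delta_method_sequence[OF d assms(3) r])
qed

section \<open>Weak convergence through pointwise convergence\<close>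

lemma weak_conv_m_Suc_iff: "weak_conv_m (\<lambda>k. A (Suc k)) B \<longleftrightarrow> weak_conv_m A B"
  unfolding weak_conv_m_def weak_conv_def
  using filterlim_sequentially_Suc[of "\<lambda>k. cdf (A k) _"] by simp

text \<open>Dimension 0 carries no hypotheses, so laws are identified only from index 1 on; a single
  term does not affect the limit.\<close>

lemma weak_conv_m_cong_positive:
  assumes "\<And>k. k \<ge> 1 \<Longrightarrow> A k = A' k"
  shows "weak_conv_m A B \<longleftrightarrow> weak_conv_m A' B"
  using assms weak_conv_m_Suc_iff[of A B] weak_conv_m_Suc_iff[of A' B] by simp

text \<open>Dominated convergence for continuous test functions bounded by 1, with the constant 1 as
  the dominating function.\<close>

lemma weak_conv_m_pointwise:
  assumes "prob_space P"
    and f: "\<And>k. f k \<in> borel_measurable P" and g: "g \<in> borel_measurable P"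
    and lim: "\<And>x. x \<in> space P \<Longrightarrow> (\<lambda>k. f k x) \<longlonglongrightarrow> g x"
  shows "weak_conv_m (\<lambda>k. distr P borel (f k)) (distr P borel g)"
proof -
  interpret prob_space P by fact
  note [measurable] = f g
  show ?thesis
  proof (rule integral_bdd_continuous_conv_imp_weak_conv)
    show "real_distribution (distr P borel (f k))" for k by (rule real_distribution_distr) measurable
    show "real_distribution (distr P borel g)" by (rule real_distribution_distr) measurable
    fix F :: "real \<Rightarrow> real" assume F: "\<And>x. isCont F x" "\<And>x. \<bar>F x\<bar> \<le> 1"
    have [measurable]: "F \<in> borel_measurable borel"
      using F by (intro borel_measurable_continuous_onI) (simp add: continuous_at_imp_continuous_on)
    have "(\<lambda>k. \<integral>x. F (f k x) \<partial>P) \<longlonglongrightarrow> (\<integral>x. F (g x) \<partial>P)"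
    proof (rule integral_dominated_convergence[where w="\<lambda>_. 1"])
      show "AE x in P. (\<lambda>k. F (f k x)) \<longlonglongrightarrow> F (g x)"
        using lim by (auto intro!: AE_I2 isCont_tendsto_compose[OF F(1)])
    qed (use F in auto)
    then show "(\<lambda>k. \<integral>x. F x \<partial>distr P borel (f k)) \<longlonglongrightarrow> (\<integral>x. F x \<partial>distr P borel g)"
      by (simp add: integral_distr)
  qed
qed

text \<open>The continuous mapping theorem: a Skorohod representation turns it into continuity of
  \<open>f\<close> along pointwise convergent sequences. It is needed to rescale the limit in the
  central limit theorem.\<close>

lemma weak_conv_m_continuous_map:
  assumes \<mu>: "\<And>k. real_distribution (\<mu> k)" and \<nu>: "real_distribution \<nu>"
    and conv: "weak_conv_m \<mu> \<nu>" and f: "continuous_on UNIV f"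
  shows "weak_conv_m (\<lambda>k. distr (\<mu> k) borel f) (distr \<nu> borel f)"
proof -
  obtain \<Omega> :: "real measure" and Y :: "nat \<Rightarrow> real \<Rightarrow> real" and Y' :: "real \<Rightarrow> real"
    where \<Omega>: "prob_space \<Omega>"
      and Y[measurable]: "\<And>k. Y k \<in> borel_measurable \<Omega>" and dY: "\<And>k. distr \<Omega> borel (Y k) = \<mu> k"
      and Y'0: "Y' \<in> measurable \<Omega> lborel" and dY': "distr \<Omega> borel Y' = \<nu>"
      and Ylim: "\<And>x. x \<in> space \<Omega> \<Longrightarrow> (\<lambda>k. Y k x) \<longlonglongrightarrow> Y' x"
    using Skorohod[OF \<mu> \<nu> conv] by metis
  have [measurable]: "Y' \<in> borel_measurable \<Omega>" "f \<in> borel_measurable borel"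
    using Y'0 f by (simp_all add: borel_measurable_continuous_onI)
  have "weak_conv_m (\<lambda>k. distr \<Omega> borel (\<lambda>x. f (Y k x))) (distr \<Omega> borel (\<lambda>x. f (Y' x)))"
    using Ylim by (intro weak_conv_m_pointwise[OF \<Omega>] continuous_on_tendsto_compose[OF f]) auto
  then show ?thesis
    by (simp add: dY[symmetric] dY'[symmetric] distr_distr comp_def)
qed

text \<open>An extended continuous mapping theorem for independent coordinates. The maps
  \<open>h k\<close> may vary with \<open>k\<close>, because the centring and scaling of the norms
  depend on the dimension; continuity is therefore replaced by the sequential condition
  \<open>lim\<close>.\<close>

lemma weak_conv_m_PiM_map:
  fixes \<mu> :: "nat \<Rightarrow> real measure" and \<nu> :: "real measure"
    and h :: "nat \<Rightarrow> ('i \<Rightarrow> real) \<Rightarrow> real"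
  assumes \<mu>: "\<And>k. real_distribution (\<mu> k)" and \<nu>: "real_distribution \<nu>"
    and conv: "weak_conv_m \<mu> \<nu>" and I: "finite I"
    and h[measurable]: "\<And>k. h k \<in> borel_measurable (\<Pi>\<^sub>M i\<in>I. borel)"
    and h'[measurable]: "h' \<in> borel_measurable (\<Pi>\<^sub>M i\<in>I. borel)"
    and lim: "\<And>w w'. (\<And>i. i \<in> I \<Longrightarrow> (\<lambda>k. w k i) \<longlonglongrightarrow> w' i) \<Longrightarrow> (\<lambda>k. h k (w k)) \<longlonglongrightarrow> h' w'"
  shows "weak_conv_m (\<lambda>k. distr (\<Pi>\<^sub>M i\<in>I. \<mu> k) borel (h k)) (distr (\<Pi>\<^sub>M i\<in>I. \<nu>) borel h')"
proof -
  obtain \<Omega> :: "real measure" and Y :: "nat \<Rightarrow> real \<Rightarrow> real" and Y' :: "real \<Rightarrow> real"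
    where \<Omega>: "prob_space \<Omega>"
      and Y[measurable]: "\<And>k. Y k \<in> borel_measurable \<Omega>" and dY: "\<And>k. distr \<Omega> borel (Y k) = \<mu> k"
      and Y'0: "Y' \<in> measurable \<Omega> lborel" and dY': "distr \<Omega> borel Y' = \<nu>"
      and Ylim: "\<And>x. x \<in> space \<Omega> \<Longrightarrow> (\<lambda>k. Y k x) \<longlonglongrightarrow> Y' x"
    using Skorohod[OF \<mu> \<nu> conv] by metis
  have Y'[measurable]: "Y' \<in> borel_measurable \<Omega>" using Y'0 by simp
  \<comment> \<open>Applying the same \<open>Y k\<close> in each coordinate of this product gives
    independent variables of law \<open>\<mu> k\<close>, which converge coordinatewise at every
    point.\<close>
  let ?P = "\<Pi>\<^sub>M i\<in>I. \<Omega>"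
  interpret P: prob_space ?P by (intro prob_space_PiM \<Omega>)
  have B: "prob_space (return borel (0::real))" by (intro prob_space_return) simp
  \<comment> \<open>The library lemma asks for probability spaces as targets, hence the Dirac measure in place of
    \<open>borel\<close>; only its \<open>\<sigma>\<close>-algebra matters.\<close>
  have push: "distr ?P (\<Pi>\<^sub>M i\<in>I. borel) (compose I y) = (\<Pi>\<^sub>M i\<in>I. distr \<Omega> borel y)"
    if [measurable]: "y \<in> borel_measurable \<Omega>" for y :: "real \<Rightarrow> real"
  proof -
    have "distr ?P (\<Pi>\<^sub>M i\<in>I. return borel (0::real)) (compose I y)
        = (\<Pi>\<^sub>M i\<in>I. distr \<Omega> (return borel (0::real)) y)"
      using \<Omega> B I by (intro distr_PiM_finite_prob_space') auto
    moreover have "distr ?P (\<Pi>\<^sub>M i\<in>I. return borel (0::real)) (compose I y)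
        = distr ?P (\<Pi>\<^sub>M i\<in>I. borel) (compose I y)"
      by (intro distr_cong sets_PiM_cong) auto
    moreover have "distr \<Omega> (return borel (0::real)) y = distr \<Omega> borel y"
      by (intro distr_cong) auto
    ultimately show ?thesis by simp
  qed
  have law: "distr ?P borel (\<lambda>x. g (compose I y x)) = distr (\<Pi>\<^sub>M i\<in>I. distr \<Omega> borel y) borel g"
    if [measurable]: "y \<in> borel_measurable \<Omega>" "g \<in> borel_measurable (\<Pi>\<^sub>M i\<in>I. borel)"
    for y :: "real \<Rightarrow> real" and g :: "('i \<Rightarrow> real) \<Rightarrow> real"
  proof -
    have [measurable]: "compose I y \<in> measurable ?P (\<Pi>\<^sub>M i\<in>I. borel)"
      unfolding compose_def by measurable
    show ?thesis
      unfolding push[OF that(1), symmetric] by (subst distr_distr) (auto simp: comp_def)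
  qed
  have "weak_conv_m (\<lambda>k. distr ?P borel (\<lambda>x. h k (compose I (Y k) x)))
      (distr ?P borel (\<lambda>x. h' (compose I Y' x)))"
  proof (rule weak_conv_m_pointwise[OF P.prob_space_axioms])
    fix x assume "x \<in> space ?P"
    then show "(\<lambda>k. h k (compose I (Y k) x)) \<longlonglongrightarrow> h' (compose I Y' x)"
      by (intro lim) (auto simp: compose_def space_PiM intro!: Ylim)
  qed (unfold compose_def, measurable)
  then show ?thesis
    by (simp add: law dY dY')
qed

section \<open>Laws of independent families and the central limit theorem\<close>

text \<open>Independence says that the joint law is the product of the marginals. This moves
  statistics of the given variables to a product measure, where only the common law \<open>D\<close>
  matters.\<close>

lemma (in prob_space) distr_iid:
  assumes ind: "indep_vars (\<lambda>_. borel) Y I" and "I \<noteq> {}"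
    and law: "\<And>i. i \<in> I \<Longrightarrow> distr M borel (Y i) = D"
    and h[measurable]: "h \<in> measurable (\<Pi>\<^sub>M i\<in>I. borel) L"
  shows "distr M L (\<lambda>x. h (\<lambda>i\<in>I. Y i x)) = distr (\<Pi>\<^sub>M i\<in>I. D) L h"
proof -
  have [measurable]: "\<And>i. i \<in> I \<Longrightarrow> random_variable borel (Y i)"
    using ind unfolding indep_vars_def by auto
  have "(\<Pi>\<^sub>M i\<in>I. D) = (\<Pi>\<^sub>M i\<in>I. distr M borel (Y i))"
    using law by (intro PiM_cong) auto
  also have "\<dots> = distr M (\<Pi>\<^sub>M i\<in>I. borel) (\<lambda>x. \<lambda>i\<in>I. Y i x)"
    using indep_vars_iff_distr_eq_PiM'[where M'="\<lambda>_. borel" and X=Y and I=I] assms by simp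
  finally show ?thesis
    by (simp add: distr_distr comp_def)
qed

text \<open>Both characteristic functions are the power of \<open>char D\<close> with exponent the
  number of summands, and Levy's uniqueness theorem applies. The two families may live on different
  spaces.\<close>

lemma distr_sum_iid_cong:
  fixes X :: "'i \<Rightarrow> 'a \<Rightarrow> real" and Y :: "'j \<Rightarrow> 'b \<Rightarrow> real"
  assumes "prob_space P" "prob_space Q"
    and X: "prob_space.indep_vars P (\<lambda>_. borel) X A" "\<And>i. i \<in> A \<Longrightarrow> distr P borel (X i) = D"
    and Y: "prob_space.indep_vars Q (\<lambda>_. borel) Y B" "\<And>i. i \<in> B \<Longrightarrow> distr Q borel (Y i) = D"
    and "card A = card B"
  shows "distr P borel (\<lambda>x. \<Sum>i\<in>A. X i x) = distr Q borel (\<lambda>x. \<Sum>i\<in>B. Y i x)"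
proof -
  interpret P: prob_space P by fact
  interpret Q: prob_space Q by fact
  have [measurable]: "\<And>i. i \<in> A \<Longrightarrow> X i \<in> borel_measurable P" "\<And>i. i \<in> B \<Longrightarrow> Y i \<in> borel_measurable Q"
    using X Y unfolding P.indep_vars_def Q.indep_vars_def by auto
  show ?thesis
  proof (rule Levy_uniqueness)
    show "char (distr P borel (\<lambda>x. \<Sum>i\<in>A. X i x)) = char (distr Q borel (\<lambda>x. \<Sum>i\<in>B. Y i x))"
      using assms by (intro ext) (simp add: P.char_distr_sum Q.char_distr_sum)
  qed (auto intro!: P.real_distribution_distr Q.real_distribution_distr)
qed

text \<open>The central limit theorem concerns one sequence on one space, whereas row
  \<open>d\<close> lives on its own space \<open>M d\<close>. Since only laws matter, each row is
  replaced by the first \<open>d\<close> coordinates of the infinite power of \<open>D\<close>. Zero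
  variance is allowed.\<close>

lemma weak_conv_m_clt_array:
  fixes D :: "real measure" and Y :: "nat \<Rightarrow> nat \<Rightarrow> 'a \<Rightarrow> real"
  assumes D: "real_distribution D"
    and int: "integrable D (\<lambda>x. x)" and sq: "integrable D (\<lambda>x. (x - m)\<^sup>2)"
    and m: "(LINT x|D. x) = m" and \<sigma>: "\<sigma> = sqrt (LINT x|D. (x - m)\<^sup>2)"
    and M: "\<And>d. d \<ge> 1 \<Longrightarrow> prob_space (M d)"
    and ind: "\<And>d. d \<ge> 1 \<Longrightarrow> prob_space.indep_vars (M d) (\<lambda>_. borel) (Y d) {1..d}"
    and law: "\<And>d j. d \<ge> 1 \<Longrightarrow> j \<in> {1..d} \<Longrightarrow> distr (M d) borel (Y d j) = D"
  shows "weak_conv_m (\<lambda>d. distr (M d) borel (\<lambda>\<omega>. ((\<Sum>j\<in>{1..d}. Y d j \<omega>) - real d * m) / sqrt (real d)))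
    (distr std_normal_distribution borel (\<lambda>x. \<sigma> * x))"
proof -
  interpret D: real_distribution D by fact
  let ?P = "\<Pi>\<^sub>M j\<in>(UNIV :: nat set). D"
  let ?W = "\<lambda>d x. ((\<Sum>j<d. x j) - real d * m) / sqrt (real d)"
  interpret P: prob_space ?P by (intro prob_space_PiM D.prob_space_axioms)
  have coord: "distr ?P borel (\<lambda>x. x j) = D" for j
  proof -
    have "distr ?P borel (\<lambda>x. x j) = distr ?P D (\<lambda>x. x j)"
      by (intro distr_cong) auto
    also have "\<dots> = D"
      using distr_PiM_component[of UNIV "\<lambda>_. D" j] D.prob_space_axioms by auto
    finally show ?thesis .
  qed
  \<comment> \<open>The joint map of all coordinates is the identity, so its law is the product
    measure itself.\<close>
  have indP: "P.indep_vars (\<lambda>_. borel) (\<lambda>j x. x j) (UNIV :: nat set)"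
    by (subst P.indep_vars_iff_distr_eq_PiM')
      (auto simp: coord restrict_UNIV intro!: distr_id2 sets_PiM_cong)
  have [measurable]: "(\<lambda>x. x j) \<in> borel_measurable ?P" for j
    using indP unfolding P.indep_vars_def by auto
  have eq: "distr (M d) borel (\<lambda>\<omega>. ((\<Sum>j\<in>{1..d}. Y d j \<omega>) - real d * m) / sqrt (real d))
      = distr ?P borel (?W d)" if d: "d \<ge> 1" for d
  proof -
    interpret Md: prob_space "M d" by (rule M[OF d])
    have [measurable]: "\<And>j. j \<in> {1..d} \<Longrightarrow> Y d j \<in> borel_measurable (M d)"
      using ind[OF d] unfolding Md.indep_vars_def by auto
    \<comment> \<open>The index sets \<open>{1..d}\<close> and \<open>{..<d}\<close> differ by a
      shift, but only their common cardinality counts.\<close>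
    have "distr (M d) borel (\<lambda>\<omega>. \<Sum>j\<in>{1..d}. Y d j \<omega>) = distr ?P borel (\<lambda>x. \<Sum>j<d. x j)"
      using d ind law P.indep_vars_subset[OF indP, of "{..<d}"]
      by (intro distr_sum_iid_cong[where D=D]) (auto simp: coord Md.prob_space_axioms P.prob_space_axioms)
    then have "distr (distr (M d) borel (\<lambda>\<omega>. \<Sum>j\<in>{1..d}. Y d j \<omega>)) borel (\<lambda>s. (s - real d * m) / sqrt (real d))
      = distr (distr ?P borel (\<lambda>x. \<Sum>j<d. x j)) borel (\<lambda>s. (s - real d * m) / sqrt (real d))"
      by simp
    then show ?thesis
      by (simp add: distr_distr comp_def)
  qed
  have \<sigma>2: "\<sigma>\<^sup>2 = (LINT x|D. (x - m)\<^sup>2)" and \<sigma>0: "\<sigma> \<ge> 0"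
    unfolding \<sigma> by simp_all
  have "weak_conv_m (\<lambda>d. distr ?P borel (?W d)) (distr std_normal_distribution borel (\<lambda>x. \<sigma> * x))"
  \<comment> \<open>The central limit theorem requires positive variance. For
    \<open>\<sigma> = 0\<close> the summands are almost surely \<open>m\<close>, and both the
    normalised sums and the limit are the point mass at 0.\<close>
  proof (cases "\<sigma> = 0")
    case True
    have "AE x in D. x = m"
      using True \<sigma>2 integral_nonneg_eq_0_iff_AE[OF sq] by simp
    then have "AE x in ?P. x j = m" for j
      by (intro AE_PiM_component D.prob_space_axioms) auto
    then have AE: "AE x in ?P. \<forall>j. x j = m"
      by (subst AE_all_countable) auto
    have "distr ?P borel (?W d) = distr ?P borel (\<lambda>_. 0)" for d
      using AE by (intro distr_cong_AE) auto
    also have "\<dots> = return borel 0"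
      by simp
    finally have "distr ?P borel (?W d) = return borel 0" for d .
    moreover have "distr std_normal_distribution borel (\<lambda>x. \<sigma> * x) = return borel 0"
      using True prob_space.distr_const[OF prob_space_normal_density[of 1 0], of 0 borel] by simp
    ultimately show ?thesis
      by (simp add: weak_conv_m_def weak_conv_def)
  next
    case False
    have coord_integral: "(LINT x|?P. f (x j)) = (LINT x|D. f x)"
      and coord_integrable: "integrable ?P (\<lambda>x. f (x j)) \<longleftrightarrow> integrable D f"
      if [measurable]: "f \<in> borel_measurable borel" for f :: "real \<Rightarrow> real" and j
      using integral_distr[of "\<lambda>x. x j" ?P borel f] integrable_distr_eq[of "\<lambda>x. x j" ?P borel f]
      by (simp_all add: coord)
    \<comment> \<open>This integrand is \<open>x\<^sup>2\<close> in expanded form: the raw second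
      moment is recovered from the centred one.\<close>
    have "integrable D (\<lambda>x. (x - m)\<^sup>2 + (2 * m * x - m\<^sup>2))"
      by (intro Bochner_Integration.integrable_add sq Bochner_Integration.integrable_diff
          integrable_mult_right int) auto
    then have sq': "integrable D (\<lambda>x. x\<^sup>2)"
      by (simp add: power2_eq_square algebra_simps)
    have mean: "P.expectation (\<lambda>x. x j) = m" for j
      using coord_integral[of "\<lambda>x. x" j] m by simp
    have clt: "weak_conv_m (\<lambda>d. distr ?P borel (\<lambda>x. (\<Sum>j<d. x j - m) / sqrt (real d * \<sigma>\<^sup>2)))
        std_normal_distribution"
    proof (rule P.central_limit_theorem[OF indP mean])
      show "\<sigma> > 0" using False \<sigma>0 by simp
      show "integrable ?P (\<lambda>x. (x j)\<^sup>2)" for j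
        using coord_integrable[of "\<lambda>x. x\<^sup>2"] sq' by simp
      show "P.variance (\<lambda>x. x j) = \<sigma>\<^sup>2" for j
        unfolding mean \<sigma>2 using coord_integral[of "\<lambda>x. (x - m)\<^sup>2"] by simp
      show "distr ?P borel (\<lambda>x. x j) = D" for j by (rule coord)
    qed
    \<comment> \<open>Multiplying by \<open>\<sigma>\<close> undoes the normalisation to unit
      variance.\<close>
    have "weak_conv_m (\<lambda>d. distr (distr ?P borel (\<lambda>x. (\<Sum>j<d. x j - m) / sqrt (real d * \<sigma>\<^sup>2))) borel (\<lambda>x. \<sigma> * x))
        (distr std_normal_distribution borel (\<lambda>x. \<sigma> * x))"
      by (intro weak_conv_m_continuous_map clt real_dist_normal_dist P.real_distribution_distr
          continuous_intros) measurable
    moreover have "distr (distr ?P borel (\<lambda>x. (\<Sum>j<d. x j - m) / sqrt (real d * \<sigma>\<^sup>2))) borel (\<lambda>x. \<sigma> * x)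
        = distr ?P borel (?W d)" for d
      using False \<sigma>0 by (simp add: distr_distr comp_def real_sqrt_mult sum_subtractf)
    ultimately show ?thesis by simp
  qed
  then show ?thesis
    using weak_conv_m_cong_positive[OF eq] by simp
qed

section \<open>The range of the norms\<close>

theorem proposition4:
  fixes p :: real and n :: nat
    and N :: "'b measure" and X :: "'b \<Rightarrow> real"
    and M :: "nat \<Rightarrow> 'a measure" and V :: "nat \<Rightarrow> nat \<Rightarrow> 'a \<Rightarrow> nat \<Rightarrow> real"
    and K :: "'c measure" and Z :: "nat \<Rightarrow> 'c \<Rightarrow> real"
  assumes "p > 0" and "n \<ge> 1"
    and "prob_space N" and "X \<in> borel_measurable N"
    and "integrable N (\<lambda>\<omega>. \<bar>X \<omega>\<bar> powr p)" and "0 < abs_moment N X p"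
    and "integrable N (\<lambda>\<omega>. (\<bar>X \<omega>\<bar> powr p - abs_moment N X p)\<^sup>2)"
    and "\<And>d. d \<ge> 1 \<Longrightarrow> prob_space (M d)"
    and "\<And>d. d \<ge> 1 \<Longrightarrow> iid (M d) (real_vec d) {1..n} (V d)"
    and "\<And>d i. d \<ge> 1 \<Longrightarrow> i \<in> {1..n} \<Longrightarrow> iid (M d) borel {1..d} (\<lambda>j \<omega>. V d i \<omega> j)"
    and "\<And>d i j. d \<ge> 1 \<Longrightarrow> i \<in> {1..n} \<Longrightarrow> j \<in> {1..d} \<Longrightarrow>
           distr (M d) borel (\<lambda>\<omega>. V d i \<omega> j) = distr N borel X"
    and "prob_space K"
    and "iid K borel {1..n} Z"
    and "\<And>i. i \<in> {1..n} \<Longrightarrow> distributed K lborel (Z i) std_normal_density"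
  shows "weak_conv_m
    (\<lambda>d. distr (M d) borel (\<lambda>\<omega>. real d powr (1 / 2 - 1 / p) *
       ((MAX i\<in>{1..n}. lp_norm d p (V d i \<omega>)) - (MIN i\<in>{1..n}. lp_norm d p (V d i \<omega>)))))
    (distr K borel (\<lambda>\<omega>. abs_sd N X p * abs_moment N X p powr (1 / p - 1) / p *
       ((MAX i\<in>{1..n}. Z i \<omega>) - (MIN i\<in>{1..n}. Z i \<omega>))))"
proof -
  note M = assms(8)
  interpret N: prob_space N by fact
  interpret K: prob_space K by fact
  note [measurable] = \<open>X \<in> borel_measurable N\<close>
  define m where "m = abs_moment N X p"
  define s where "s = abs_sd N X p"
  \<comment> \<open>The derivative of \<open>x powr (1 / p)\<close> at \<open>m\<close>.\<close>
  define c where "c = m powr (1 / p - 1) / p"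
  define I where "I = {1..n}"
  define D where "D = distr N borel (\<lambda>\<omega>. \<bar>X \<omega>\<bar> powr p)"
  define g :: "nat \<Rightarrow> (nat \<Rightarrow> real) \<Rightarrow> real"
    where "g d x = ((\<Sum>j\<in>{1..d}. \<bar>x j\<bar> powr p) - real d * m) / sqrt (real d)" for d x
  define G where "G d = distr (M d) borel (\<lambda>\<omega>. g d (V d 1 \<omega>))" for d
  \<comment> \<open>\<open>h d\<close> rebuilds the scaled range of the norms from the normalised
    sums \<open>w i\<close>, by inverting the normalisation in \<open>g\<close>; \<open>h'\<close>
    is its limit.\<close>
  define h :: "nat \<Rightarrow> (nat \<Rightarrow> real) \<Rightarrow> real" where "h d w = real d powr (1 / 2 - 1 / p) *
     ((MAX i\<in>I. (real d * m + sqrt (real d) * w i) powr (1 / p))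
      - (MIN i\<in>I. (real d * m + sqrt (real d) * w i) powr (1 / p)))" for d w
  define h' :: "(nat \<Rightarrow> real) \<Rightarrow> real" where "h' w = c * ((MAX i\<in>I. w i) - (MIN i\<in>I. w i))" for w
  let ?\<nu> = "distr std_normal_distribution borel (\<lambda>x. s * x)"
  have m: "m > 0" and s: "s \<ge> 0" and c: "c \<ge> 0"
    using assms by (auto simp: m_def s_def abs_sd_def c_def abs_moment_def)
  have I: "finite I" "I \<noteq> {}" "1 \<in> I"
    using \<open>n \<ge> 1\<close> by (auto simp: I_def)

  have h_meas: "h d \<in> borel_measurable (\<Pi>\<^sub>M i\<in>I. borel)" for d
    unfolding h_def[abs_def] using I(1) by measurable
  have h'_meas: "h' \<in> borel_measurable (\<Pi>\<^sub>M i\<in>I. borel)"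
    unfolding h'_def[abs_def] using I(1) by measurable
  have g_meas[measurable]: "g d \<in> borel_measurable (real_vec d)" for d
    unfolding g_def[abs_def] real_vec_def by measurable

  have V_meas[measurable]: "V d i \<in> measurable (M d) (real_vec d)" if "d \<ge> 1" "i \<in> I" for d i
    using assms(9)[OF that(1)] that(2) unfolding iid_def prob_space.indep_vars_def[OF M[OF that(1)]]
    by (auto simp: I_def)
  have same: "distr (M d) (real_vec d) (V d i) = distr (M d) (real_vec d) (V d 1)"
    if "d \<ge> 1" "i \<in> I" for d i
    using assms(9)[OF that(1)] that(2) I(3) unfolding iid_def I_def by blast
  have G: "distr (M d) borel (\<lambda>\<omega>. g d (V d i \<omega>)) = G d" if d: "d \<ge> 1" "i \<in> I" for d i
  proof -
    have "distr (distr (M d) (real_vec d) (V d i)) borel (g d)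
        = distr (distr (M d) (real_vec d) (V d 1)) borel (g d)"
      by (simp add: same[OF d])
    then show ?thesis
      using d I(3) by (simp add: distr_distr comp_def G_def)
  qed
  have G_conv: "weak_conv_m G ?\<nu>"
    unfolding G_def g_def
  proof (rule weak_conv_m_clt_array[OF _ _ _ _ _ M])
    show "real_distribution D"
      unfolding D_def by (rule N.real_distribution_distr) measurable
    show "integrable D (\<lambda>x. x)" "integrable D (\<lambda>x. (x - m)\<^sup>2)" "(LINT x|D. x) = m"
      "s = sqrt (LINT x|D. (x - m)\<^sup>2)"
      using assms(5,7) unfolding D_def m_def s_def abs_sd_def
      by (simp_all add: integrable_distr_eq integral_distr) (simp add: abs_moment_def)
    fix d :: nat assume d: "d \<ge> 1"
    interpret Md: prob_space "M d" by (rule M[OF d])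
    have iid: "Md.indep_vars (\<lambda>_. borel) (\<lambda>j \<omega>. V d 1 \<omega> j) {1..d}"
      using assms(10)[OF d, of 1] I(3) unfolding iid_def I_def by blast
    then show "Md.indep_vars (\<lambda>_. borel) (\<lambda>j \<omega>. \<bar>V d 1 \<omega> j\<bar> powr p) {1..d}"
      by (rule Md.indep_vars_compose2) measurable
    fix j assume j: "j \<in> {1..d}"
    have [measurable]: "(\<lambda>\<omega>. V d 1 \<omega> j) \<in> borel_measurable (M d)"
      using iid j unfolding Md.indep_vars_def by auto
    have "distr (distr (M d) borel (\<lambda>\<omega>. V d 1 \<omega> j)) borel (\<lambda>x. \<bar>x\<bar> powr p)
        = distr (distr N borel X) borel (\<lambda>x. \<bar>x\<bar> powr p)"
      using assms(11)[OF d _ j, of 1] I(3) by (simp add: I_def)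
    then show "distr (M d) borel (\<lambda>\<omega>. \<bar>V d 1 \<omega> j\<bar> powr p) = D"
      by (simp add: distr_distr comp_def D_def del: One_nat_def)
  qed

  have left: "distr (M d) borel (\<lambda>\<omega>. real d powr (1 / 2 - 1 / p) *
       ((MAX i\<in>I. lp_norm d p (V d i \<omega>)) - (MIN i\<in>I. lp_norm d p (V d i \<omega>))))
     = distr (\<Pi>\<^sub>M i\<in>I. G d) borel (h d)" if d: "d \<ge> 1" for d
  proof -
    interpret Md: prob_space "M d" by (rule M[OF d])
    have "Md.indep_vars (\<lambda>_. real_vec d) (V d) I"
      using assms(9)[OF d] unfolding iid_def I_def by blast
    then have "Md.indep_vars (\<lambda>_. borel) (\<lambda>i \<omega>. g d (V d i \<omega>)) I"
      by (rule Md.indep_vars_compose2) measurable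
    from Md.distr_iid[OF this I(2) G[OF d] h_meas]
    have "distr (M d) borel (\<lambda>\<omega>. h d (\<lambda>i\<in>I. g d (V d i \<omega>))) = distr (\<Pi>\<^sub>M i\<in>I. G d) borel (h d)" .
    \<comment> \<open>Since \<open>d\<close> is positive, \<open>sqrt d\<close> cancels and the base
      in \<open>h\<close> is exactly the sum of the \<open>p\<close>-th powers.\<close>
    moreover have "h d (\<lambda>i\<in>I. g d (V d i \<omega>)) = real d powr (1 / 2 - 1 / p) *
       ((MAX i\<in>I. lp_norm d p (V d i \<omega>)) - (MIN i\<in>I. lp_norm d p (V d i \<omega>)))" for \<omega>
      using d by (simp add: h_def g_def lp_norm_def)
    ultimately show ?thesis by simp
  qed

  have right: "distr K borel (\<lambda>\<omega>. s * m powr (1 / p - 1) / p *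
       ((MAX i\<in>I. Z i \<omega>) - (MIN i\<in>I. Z i \<omega>))) = distr (\<Pi>\<^sub>M i\<in>I. ?\<nu>) borel h'"
  proof -
    have Z: "K.indep_vars (\<lambda>_. borel) Z I"
      using assms(13) unfolding iid_def I_def by blast
    then have sZ: "K.indep_vars (\<lambda>_. borel) (\<lambda>i \<omega>. s * Z i \<omega>) I"
      by (rule K.indep_vars_compose2) measurable
    have "distr K borel (\<lambda>\<omega>. s * Z i \<omega>) = ?\<nu>" if i: "i \<in> I" for i
    proof -
      have [measurable]: "Z i \<in> borel_measurable K"
        using Z i unfolding K.indep_vars_def by auto
      have "distr K lborel (Z i) = std_normal_distribution"
        using assms(14) i unfolding distributed_def I_def by blast
      moreover have "distr K lborel (Z i) = distr K borel (Z i)"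
        by (rule distr_cong) auto
      ultimately show ?thesis
        by (simp add: distr_distr comp_def flip: \<open>distr K lborel (Z i) = std_normal_distribution\<close>)
    qed
    from K.distr_iid[OF sZ I(2) this h'_meas]
    have "distr K borel (\<lambda>\<omega>. h' (\<lambda>i\<in>I. s * Z i \<omega>)) = distr (\<Pi>\<^sub>M i\<in>I. ?\<nu>) borel h'" .
    moreover have "h' (\<lambda>i\<in>I. s * Z i \<omega>) = s * m powr (1 / p - 1) / p *
       ((MAX i\<in>I. Z i \<omega>) - (MIN i\<in>I. Z i \<omega>))" for \<omega>
      using range_affine[OF I(1,2) s, of "\<lambda>i. Z i \<omega>" 0] by (simp add: h'_def c_def)
    ultimately show ?thesis by simp
  qed

  \<comment> \<open>The shift to \<open>Suc k\<close> makes every dimension positive, so that each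
    \<open>G (Suc k)\<close> is a probability law.\<close>
  have "weak_conv_m (\<lambda>k. distr (\<Pi>\<^sub>M i\<in>I. G (Suc k)) borel (h (Suc k)))
      (distr (\<Pi>\<^sub>M i\<in>I. ?\<nu>) borel h')"
  proof (rule weak_conv_m_PiM_map[OF _ _ _ I(1) h_meas h'_meas])
    show "real_distribution (G (Suc k))" for k
      unfolding G_def using I(3)
      by (intro prob_space.real_distribution_distr M) auto
    show "real_distribution ?\<nu>"
      using real_dist_normal_dist
      by (intro prob_space.real_distribution_distr) (auto simp: real_distribution_def)
    show "weak_conv_m (\<lambda>k. G (Suc k)) ?\<nu>"
      using G_conv by (simp add: weak_conv_m_Suc_iff)
    fix w :: "nat \<Rightarrow> nat \<Rightarrow> real" and w' assume w: "\<And>i. i \<in> I \<Longrightarrow> (\<lambda>k. w k i) \<longlonglongrightarrow> w' i"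
    \<comment> \<open>Subtracting the common centring \<open>(d * m) powr (1 / p)\<close>, with
      \<open>d = Suc k\<close>, leaves the range unchanged and makes each term converge by the delta
      method.\<close>
    define q where "q k i = real (Suc k) powr (1 / 2 - 1 / p) *
      ((real (Suc k) * m + sqrt (real (Suc k)) * w k i) powr (1 / p) - (real (Suc k) * m) powr (1 / p))"
      for k i
    have q: "(\<lambda>k. q k i) \<longlonglongrightarrow> c * w' i" if "i \<in> I" for i
      unfolding q_def c_def by (intro powr_increment_tendsto \<open>p > 0\<close> m w that)
    have "(\<lambda>k. (MAX i\<in>I. q k i) - (MIN i\<in>I. q k i))
        \<longlonglongrightarrow> (MAX i\<in>I. c * w' i) - (MIN i\<in>I. c * w' i)"
      using I q by (intro tendsto_diff tendsto_MAX tendsto_MIN) auto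
    moreover have "(MAX i\<in>I. q k i) - (MIN i\<in>I. q k i) = h (Suc k) (w k)" for k
      using range_affine[OF I(1,2), of "real (Suc k) powr (1 / 2 - 1 / p)"
          "\<lambda>i. (real (Suc k) * m + sqrt (real (Suc k)) * w k i) powr (1 / p)"
          "- (real (Suc k) powr (1 / 2 - 1 / p) * (real (Suc k) * m) powr (1 / p))"]
      unfolding q_def h_def by (simp add: right_diff_distrib)
    moreover have "(MAX i\<in>I. c * w' i) - (MIN i\<in>I. c * w' i) = h' w'"
      using range_affine[OF I(1,2) c, of w' 0] by (simp add: h'_def)
    ultimately show "(\<lambda>k. h (Suc k) (w k)) \<longlonglongrightarrow> h' w'"
      by simp
  qed
  then show ?thesis
    unfolding I_def[symmetric] m_def[symmetric] s_def[symmetric] right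
    unfolding weak_conv_m_Suc_iff[of "\<lambda>d. distr (\<Pi>\<^sub>M i\<in>I. G d) borel (h d)"]
    using weak_conv_m_cong_positive[OF left] by simp
qed

end
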